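(* Let $X$ be a continuous domain, equipped with its Scott topology. Then $O_{\Rightarrow_P}(\mathcal{SV}(X))=\sigma(\mathcal{V}(X))|_{\mathcal{SV}(X)}$; that is, $CX$ is a topological subspace of $(\mathcal{V}(X),\sigma(\mathcal{V}(X)))$.
   Context: A dcpo is a poset in which every directed (nonempty, every finite nonempty subset bounded above in it) subset has a supremum. In a dcpo, $x\ll y$ if for every directed $D$ with $y\le\bigvee D$ there is $d\in D$ with $x\le d$. A continuous domain is a dcpo in which for each $x$ the set $\{a: a\ll x\}$ is directed with supremum $x$. For a poset $P$, $\sigma(P)$ is the Scott topology: $U$ is open iff it is an upper set and, for each directed $D$ whose supremum exists and lies in $U$, $U\cap D\ne\emptyset$. The order on a $T_0$ space is the specialization order ($x\sqsubseteq y$ iff $x\in\overline{\{y\}}$). $\mathcal{O}(X)$ is the topology of $X$. A directed subset $D\subseteq X$ is regarded as a net indexed by itself, and $D\to x$ means it converges topologically to $x$. A continuous valuation is a map $\mu:\mathcal{O}(X)\to[0,+\infty]$ with $\mu(\emptyset)=0$, $\mu(V)\le\mu(U)$ for $V\subseteq U$, $\mu(U)+\mu(V)=\mu(U\cup V)+\mu(U\cap V)$, and $\mu(\bigcup\mathcal{D})=\sup_{U\in\mathcal{D}}\mu(U)$ for directed families $\mathcal{D}\subseteq\mathcal{O}(X)$. $\mathcal{V}(X)$ is the set of all continuous valuations with the pointwise order, and $\sigma(\mathcal{V}(X))$ its Scott topology. For $x\in X$, $\eta_x(U)=1$ if $x\in U$ and $0$ otherwise ($U\in\mathcal{O}(X)$).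 A simple valuation is a finite sum $\xi=\sum_{b\in B}r_b\eta_b$ with $B\subseteq X$ finite (its support; possibly empty, giving the zero valuation) and $0<r_b<\infty$, where $\xi(U)=\sum_{b\in B\cap U}r_b$. $\mathcal{SV}(X)\subseteq\mathcal{V}(X)$ is the set of simple valuations with the pointwise order $\le$. $\sigma(\mathcal{V}(X))|_{\mathcal{SV}(X)}$ is the relative topology on $\mathcal{SV}(X)$. For a $\le$-directed $\mathcal{D}\subseteq\mathcal{SV}(X)$ and $\xi=\sum_{i=1}^n r_{b_i}\eta_{b_i}\in\mathcal{SV}(X)$ (with $b_1,\dots,b_n$ the distinct elements of the support), $\mathcal{D}\Rightarrow_P\xi$ means: there are directed sets $D_i\subseteq X$ with $D_i\to b_i$ ($i=1,\dots,n$) such that for all $(d_1,\dots,d_n)\in\prod_{i=1}^n D_i$ and all reals $r'_{b_i}<r_{b_i}$ there is $\xi'\in\mathcal{D}$ with $\sum_{i=1}^n r'_{b_i}\eta_{d_i}\le\xi'$ (pointwise on open sets). $O_{\Rightarrow_P}(\mathcal{SV}(X))$ consists of the sets $\mathcal{U}\subseteq\mathcal{SV}(X)$ such that for every directed $\mathcal{D}$ and every $\xi$, $\mathcal{D}\Rightarrow_P\xi\in\mathcal{U}$ implies $\mathcal{D}\cap\mathcal{U}\ne\emptyset$; it is a topology, and $CX=(\mathcal{SV}(X),O_{\Rightarrow_P}(\mathcal{SV}(X)))$. *)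

theory Defs
  imports "HOL-Analysis.Analysis"
begin

definition poset_on :: "'a set \<Rightarrow> ('a \<Rightarrow> 'a \<Rightarrow> bool) \<Rightarrow> bool" where
  "poset_on A le \<longleftrightarrow> reflp_on A le \<and> antisymp_on A le \<and> transp_on A le"

definition directed_in :: "'a set \<Rightarrow> ('a \<Rightarrow> 'a \<Rightarrow> bool) \<Rightarrow> 'a set \<Rightarrow> bool" where
  "directed_in A le D \<longleftrightarrow> D \<subseteq> A \<and> D \<noteq> {} \<and>
     (\<forall>F. F \<subseteq> D \<and> finite F \<and> F \<noteq> {} \<longrightarrow> (\<exists>u\<in>D. \<forall>x\<in>F. le x u))"

definition is_sup_in :: "'a set \<Rightarrow> ('a \<Rightarrow> 'a \<Rightarrow> bool) \<Rightarrow> 'a set \<Rightarrow> 'a \<Rightarrow> bool" where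
  "is_sup_in A le D s \<longleftrightarrow> s \<in> A \<and> (\<forall>d\<in>D. le d s) \<and>
     (\<forall>u\<in>A. (\<forall>d\<in>D. le d u) \<longrightarrow> le s u)"

definition dcpo_on :: "'a set \<Rightarrow> ('a \<Rightarrow> 'a \<Rightarrow> bool) \<Rightarrow> bool" where
  "dcpo_on A le \<longleftrightarrow> poset_on A le \<and> (\<forall>D. directed_in A le D \<longrightarrow> (\<exists>s. is_sup_in A le D s))"

definition way_below :: "'a set \<Rightarrow> ('a \<Rightarrow> 'a \<Rightarrow> bool) \<Rightarrow> 'a \<Rightarrow> 'a \<Rightarrow> bool" where
  "way_below A le x y \<longleftrightarrow> x \<in> A \<and> y \<in> A \<and>
     (\<forall>D s. directed_in A le D \<and> is_sup_in A le D s \<and> le y s \<longrightarrow> (\<exists>d\<in>D. le x d))"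

definition continuous_domain :: "'a set \<Rightarrow> ('a \<Rightarrow> 'a \<Rightarrow> bool) \<Rightarrow> bool" where
  "continuous_domain A le \<longleftrightarrow> dcpo_on A le \<and>
     (\<forall>x\<in>A. directed_in A le {a. way_below A le a x} \<and>
             is_sup_in A le {a. way_below A le a x} x)"

definition scott_open :: "'a set \<Rightarrow> ('a \<Rightarrow> 'a \<Rightarrow> bool) \<Rightarrow> 'a set \<Rightarrow> bool" where
  "scott_open A le U \<longleftrightarrow> U \<subseteq> A \<and> (\<forall>x\<in>U. \<forall>y\<in>A. le x y \<longrightarrow> y \<in> U) \<and>
     (\<forall>D s. directed_in A le D \<and> is_sup_in A le D s \<and> s \<in> U \<longrightarrow> U \<inter> D \<noteq> {})"

definition scott_topology :: "'a set \<Rightarrow> ('a \<Rightarrow> 'a \<Rightarrow> bool) \<Rightarrow> 'a topology" where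
  "scott_topology A le = topology (scott_open A le)"

lemma directed_in_pair:
  assumes "directed_in A le D" "x \<in> D" "y \<in> D"
  shows "\<exists>u\<in>D. le x u \<and> le y u"
proof -
  have "{x, y} \<subseteq> D \<and> finite {x, y} \<and> {x, y} \<noteq> {}"
    using assms by auto
  with assms(1) have "\<exists>u\<in>D. \<forall>z\<in>{x, y}. le z u"
    unfolding directed_in_def by blast
  then show ?thesis by auto
qed

lemma istopology_scott_open: "istopology (scott_open A le)"
  unfolding istopology_def
proof (intro conjI allI impI)
  fix U V assume U: "scott_open A le U" and V: "scott_open A le V"
  show "scott_open A le (U \<inter> V)"
    unfolding scott_open_def
  proof (intro conjI allI impI)
    fix D s assume *: "directed_in A le D \<and> is_sup_in A le D s \<and> s \<in> U \<inter> V"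
    then obtain x y where xy: "x \<in> U \<inter> D" "y \<in> V \<inter> D"
      using U V unfolding scott_open_def by blast
    with * obtain u where u: "u \<in> D" "le x u" "le y u"
      using directed_in_pair[of A le D x y] by blast
    moreover have "u \<in> A" using u * unfolding directed_in_def by blast
    ultimately show "U \<inter> V \<inter> D \<noteq> {}"
      using U V xy unfolding scott_open_def by blast
  qed (use U V in \<open>unfold scott_open_def, blast+\<close>)
next
  fix K assume K: "\<forall>U\<in>K. scott_open A le U"
  show "scott_open A le (\<Union>K)"
    unfolding scott_open_def
  proof (intro conjI allI impI)
    fix D s assume *: "directed_in A le D \<and> is_sup_in A le D s \<and> s \<in> \<Union>K"
    then obtain U where "U \<in> K" "s \<in> U" by blast
    with K * have "U \<inter> D \<noteq> {}" unfolding scott_open_def by blast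
    with \<open>U \<in> K\<close> show "\<Union>K \<inter> D \<noteq> {}" by blast
  qed (use K in \<open>unfold scott_open_def, blast+\<close>)
qed

lemma openin_scott_topology: "openin (scott_topology A le) U \<longleftrightarrow> scott_open A le U"
  by (simp add: scott_topology_def istopology_scott_open topology_inverse')

definition specialization :: "'a topology \<Rightarrow> 'a \<Rightarrow> 'a \<Rightarrow> bool" where
  "specialization T x y \<longleftrightarrow> x \<in> T closure_of {y}"

text \<open>The tail filter of \<open>D\<close>, viewed as a net indexed by itself.\<close>

definition directed_net :: "'a topology \<Rightarrow> 'a set \<Rightarrow> 'a filter" where
  "directed_net T D = (INF d\<in>D. principal {e \<in> D. specialization T d e})"

definition directed_tendsto :: "'a topology \<Rightarrow> 'a set \<Rightarrow> 'a \<Rightarrow> bool" where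
  "directed_tendsto T D x \<longleftrightarrow> limitin T (\<lambda>d. d) x (directed_net T D)"

text \<open>
  A valuation is encoded as a total function that is \<^const>\<open>undefined\<close> off the open sets,
  so that HOL equality coincides with equality of maps on the topology.
\<close>

definition continuous_valuations :: "'a topology \<Rightarrow> ('a set \<Rightarrow> ennreal) set" where
  "continuous_valuations T = {\<mu> \<in> extensional {U. openin T U}.
     \<mu> {} = 0 \<and>
     (\<forall>U V. openin T U \<and> openin T V \<and> V \<subseteq> U \<longrightarrow> \<mu> V \<le> \<mu> U) \<and>
     (\<forall>U V. openin T U \<and> openin T V \<longrightarrow> \<mu> U + \<mu> V = \<mu> (U \<union> V) + \<mu> (U \<inter> V)) \<and>
     (\<forall>\<D>. directed_in {U. openin T U} (\<subseteq>) \<D> \<longrightarrow> \<mu> (\<Union>\<D>) = (SUP U\<in>\<D>. \<mu> U))}"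

definition valuation_le ::
    "'a topology \<Rightarrow> ('a set \<Rightarrow> ennreal) \<Rightarrow> ('a set \<Rightarrow> ennreal) \<Rightarrow> bool" where
  "valuation_le T \<mu> \<nu> \<longleftrightarrow> (\<forall>U. openin T U \<longrightarrow> \<mu> U \<le> \<nu> U)"

text \<open>The Dirac valuation at \<open>b\<close> is \<open>\<lambda>U. indicator U b\<close>.\<close>

definition simple_valuation ::
    "'a topology \<Rightarrow> 'a set \<Rightarrow> ('a \<Rightarrow> real) \<Rightarrow> 'a set \<Rightarrow> ennreal" where
  "simple_valuation T B r = (\<lambda>U\<in>{U. openin T U}. \<Sum>b\<in>B. ennreal (r b) * indicator U b)"

definition is_simple_rep :: "'a topology \<Rightarrow> 'a set \<Rightarrow> ('a \<Rightarrow> real) \<Rightarrow> bool" where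
  "is_simple_rep T B r \<longleftrightarrow> finite B \<and> B \<subseteq> topspace T \<and> (\<forall>b\<in>B. 0 < r b)"

definition simple_valuations :: "'a topology \<Rightarrow> ('a set \<Rightarrow> ennreal) set" where
  "simple_valuations T = {simple_valuation T B r | B r. is_simple_rep T B r}"

text \<open>
  In a \<open>T\<^sub>0\<close> space the support \<open>B\<close> and the weights \<open>r\<close> on \<open>B\<close> are determined by the simple
  valuation, so the outermost existential quantifiers only name them.  The points \<open>d b\<close>
  need not be distinct, and the coefficients \<open>r' b\<close> may be negative; hence the left-hand sum
  is formed in the reals and compared in the extended reals.
\<close>

definition P_converges ::
    "'a topology \<Rightarrow> ('a set \<Rightarrow> ennreal) set \<Rightarrow> ('a set \<Rightarrow> ennreal) \<Rightarrow> bool" where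
  "P_converges T \<D> \<xi> \<longleftrightarrow>
     (\<exists>B r. is_simple_rep T B r \<and> \<xi> = simple_valuation T B r \<and>
       (\<exists>D. (\<forall>b\<in>B. directed_in (topspace T) (specialization T) (D b) \<and>
                    directed_tendsto T (D b) b) \<and>
            (\<forall>d\<in>Pi B D. \<forall>r'. (\<forall>b\<in>B. r' b < r b) \<longrightarrow>
               (\<exists>\<xi>'\<in>\<D>. \<forall>U. openin T U \<longrightarrow>
                  ereal (\<Sum>b\<in>B. r' b * indicator U (d b)) \<le> enn2ereal (\<xi>' U)))))"

definition P_opens :: "'a topology \<Rightarrow> ('a set \<Rightarrow> ennreal) set set" where
  "P_opens T = {\<U>. \<U> \<subseteq> simple_valuations T \<and>
     (\<forall>\<D> \<xi>. directed_in (simple_valuations T) (valuation_le T) \<D> \<and>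
        P_converges T \<D> \<xi> \<and> \<xi> \<in> \<U> \<longrightarrow> \<D> \<inter> \<U> \<noteq> {})}"

definition P_space :: "'a topology \<Rightarrow> ('a set \<Rightarrow> ennreal) topology" where
  "P_space T = topology (\<lambda>\<U>. \<U> \<in> P_opens T)"

lemma specialization_refl: "x \<in> topspace T \<Longrightarrow> specialization T x x"
  by (simp add: specialization_def in_closure_of)

lemma directed_tendsto_singleton:
  assumes "x \<in> topspace T"
  shows "directed_tendsto T {x} x"
proof -
  have "{e \<in> {x}. specialization T x e} = {x}"
    using specialization_refl[OF assms] by auto
  then show ?thesis
    using assms by (simp add: directed_tendsto_def directed_net_def limitin_def eventually_principal)
qed

lemma P_converges_singleton:
  assumes "\<xi> \<in> simple_valuations T" "valuation_le T \<xi> \<xi>'"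
  shows "P_converges T {\<xi>'} \<xi>"
proof -
  obtain B r where B: "is_simple_rep T B r" and \<xi>: "\<xi> = simple_valuation T B r"
    using assms(1) by (auto simp: simple_valuations_def)
  have "ereal (\<Sum>b\<in>B. r' b * indicator U (d b)) \<le> enn2ereal (\<xi>' U)"
    if d: "d \<in> (\<Pi> b\<in>B. {b})" and r': "\<forall>b\<in>B. r' b < r b" and U: "openin T U" for d r' U
  proof -
    have pos: "r b * indicator U b \<ge> 0" if "b \<in> B" for b
      using B that by (auto simp: is_simple_rep_def indicator_def less_imp_le)
    have "(\<Sum>b\<in>B. r' b * indicator U (d b)) \<le> (\<Sum>b\<in>B. r b * indicator U b)"
      using d r' by (intro sum_mono) (auto simp: Pi_def indicator_def less_imp_le)
    also have "ereal (\<Sum>b\<in>B. r b * indicator U b) = enn2ereal (ennreal (\<Sum>b\<in>B. r b * indicator U b))"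
      using pos by (simp add: sum_nonneg)
    also have "ennreal (\<Sum>b\<in>B. r b * indicator U b) = (\<Sum>b\<in>B. ennreal (r b * indicator U b))"
      using pos by (simp add: sum_ennreal)
    also have "\<dots> = (\<Sum>b\<in>B. ennreal (r b) * indicator U b)"
      by (intro sum.cong) (auto simp: indicator_def)
    also have "\<dots> = \<xi> U"
      using U by (simp add: \<xi> simple_valuation_def)
    finally have "ereal (\<Sum>b\<in>B. r' b * indicator U (d b)) \<le> enn2ereal (\<xi> U)" by simp
    also have "\<dots> \<le> enn2ereal (\<xi>' U)"
      using assms(2) U by (simp add: valuation_le_def less_eq_ennreal.rep_eq[symmetric])
    finally show ?thesis .
  qed
  moreover have "directed_in (topspace T) (specialization T) {b}
      \<and> directed_tendsto T {b} b" if "b \<in> B" for b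
  proof -
    have "b \<in> topspace T" using B that by (auto simp: is_simple_rep_def)
    then show ?thesis
      by (auto simp: directed_in_def directed_tendsto_singleton subset_singleton_iff
          specialization_refl)
  qed
  ultimately show ?thesis
    unfolding P_converges_def using B \<xi>
    by (intro exI[of _ B] exI[of _ r] conjI exI[of _ "\<lambda>b. {b}"]) auto
qed

lemma P_opens_upper:
  assumes "\<U> \<in> P_opens T" "\<xi> \<in> \<U>" "\<xi>' \<in> simple_valuations T" "valuation_le T \<xi> \<xi>'"
  shows "\<xi>' \<in> \<U>"
proof -
  have "\<xi> \<in> simple_valuations T" using assms(1,2) by (auto simp: P_opens_def)
  then have "P_converges T {\<xi>'} \<xi>" using assms(4) by (rule P_converges_singleton)
  moreover have "directed_in (simple_valuations T) (valuation_le T) {\<xi>'}"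
    using assms(3) by (auto simp: directed_in_def valuation_le_def)
  ultimately have "{\<xi>'} \<inter> \<U> \<noteq> {}"
    using assms(1,2) unfolding P_opens_def by blast
  then show ?thesis by simp
qed

lemma istopology_P_opens: "istopology (\<lambda>\<U>. \<U> \<in> P_opens T)"
  unfolding istopology_def
proof (intro conjI allI impI)
  fix U V assume U: "U \<in> P_opens T" and V: "V \<in> P_opens T"
  have "D \<inter> (U \<inter> V) \<noteq> {}"
    if D: "directed_in (simple_valuations T) (valuation_le T) D"
      and \<xi>: "P_converges T D \<xi>" "\<xi> \<in> U \<inter> V" for D \<xi>
  proof -
    obtain x y where xy: "x \<in> D" "x \<in> U" "y \<in> D" "y \<in> V"
      using U V D \<xi> unfolding P_opens_def by blast
    then obtain u where u: "u \<in> D" "valuation_le T x u" "valuation_le T y u"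
      using directed_in_pair[OF D] by blast
    have "u \<in> simple_valuations T" using u D by (auto simp: directed_in_def)
    then show ?thesis using P_opens_upper[OF U] P_opens_upper[OF V] xy u by blast
  qed
  then show "U \<inter> V \<in> P_opens T"
    using U unfolding P_opens_def by blast
next
  fix K assume K: "\<forall>U\<in>K. U \<in> P_opens T"
  have "D \<inter> \<Union>K \<noteq> {}"
    if D: "directed_in (simple_valuations T) (valuation_le T) D"
      and \<xi>: "P_converges T D \<xi>" "\<xi> \<in> \<Union>K" for D \<xi>
  proof -
    obtain U where U: "U \<in> K" "\<xi> \<in> U" using \<xi> by blast
    then have "D \<inter> U \<noteq> {}" using K D \<xi>(1) unfolding P_opens_def by blast
    with U show ?thesis by blast
  qed
  moreover have "\<Union>K \<subseteq> simple_valuations T"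
    using K unfolding P_opens_def by blast
  ultimately show "\<Union>K \<in> P_opens T"
    unfolding P_opens_def by blast
qed

lemma openin_P_space: "openin (P_space T) \<U> \<longleftrightarrow> \<U> \<in> P_opens T"
  by (simp add: P_space_def istopology_P_opens topology_inverse')

end

theory Submission
  imports Defs
begin

text \<open>
  Both inclusions compare \<open>\<Rightarrow>\<^sub>P\<close>-convergence with directed suprema in the dcpo of all continuous
  valuations, where such suprema are computed pointwise
  (\<open>pointwise_SUP_in_continuous_valuations\<close>).

  If \<open>\<D> \<Rightarrow>\<^sub>P \<xi>\<close>, then \<open>\<xi> \<le> \<Squnion>\<D>\<close>: to test this on an open set \<open>U\<close>, move every support
  point of \<open>\<xi>\<close> in \<open>U\<close> to a point of its directed set that is still in \<open>U\<close>
  (\<open>P_converges_le_pointwise_SUP\<close>).  Hence a Scott open set of valuations that contains \<open>\<xi>\<close>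
  contains \<open>\<Squnion>\<D>\<close> and so meets \<open>\<D>\<close>.

  For the other half, let \<open>\<U>\<close> be open for \<open>\<Rightarrow>\<^sub>P\<close>.  The Scott open set inducing \<open>\<U>\<close> is simply
  the upper closure of \<open>\<U>\<close> among all continuous valuations.  The point is that an element
  \<open>\<xi> = \<Sum>b\<in>B. r b \<eta>\<^sub>b\<close> of \<open>\<U>\<close> can be lowered strictly inside \<open>\<U>\<close>: the sums
  \<open>\<Sum>b\<in>B. s b \<eta>\<^bsub>d b\<^esub>\<close> with \<open>0 < s b < r b\<close> and \<open>d b \<lless> b\<close> form a directed set which
  \<open>\<Rightarrow>\<^sub>P\<close>-converges to \<open>\<xi>\<close> because \<open>X\<close> is continuous, so one of them lies in \<open>\<U>\<close>
  (\<open>P_converges_lower_dirac_sums\<close>), and each of them is way below \<open>\<xi>\<close> among all continuous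
  valuations (\<open>way_below_dirac_sum\<close>).  If now a directed supremum of valuations is above
  \<open>\<xi>\<close>, one of the valuations is above that sum, hence in the upper closure.
\<close>

section \<open>Directed sets and the specialization order\<close>

lemma directed_inI_pairwise:
  assumes "D \<subseteq> A" "D \<noteq> {}" and trans: "transp_on A le"
    and pair: "\<And>x y. x \<in> D \<Longrightarrow> y \<in> D \<Longrightarrow> \<exists>u\<in>D. le x u \<and> le y u"
  shows "directed_in A le D"
  unfolding directed_in_def
proof (intro conjI allI impI)
  fix F assume "F \<subseteq> D \<and> finite F \<and> F \<noteq> {}"
  then have "finite F" "F \<noteq> {}" "F \<subseteq> D" by auto
  then show "\<exists>u\<in>D. \<forall>x\<in>F. le x u"
  proof (induction F rule: finite_ne_induct)
    case (singleton x)
    then show ?case using pair[of x x] by auto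
  next
    case (insert x F)
    then obtain u where u: "u \<in> D" "\<forall>z\<in>F. le z u" by auto
    from insert.prems u obtain v where v: "v \<in> D" "le x v" "le u v"
      using pair[of x u] by auto
    have "le z v" if "z \<in> F" for z
      using that u v insert.prems \<open>D \<subseteq> A\<close>
      by (intro transp_onD[OF trans, of z u v]) auto
    with v show ?case by auto
  qed
qed (use assms in auto)

lemma specialization_iff:
  "specialization T x y \<longleftrightarrow> x \<in> topspace T \<and> (\<forall>U. openin T U \<and> x \<in> U \<longrightarrow> y \<in> U)"
  by (auto simp: specialization_def in_closure_of)

lemma specialization_trans:
  "specialization T x y \<Longrightarrow> specialization T y z \<Longrightarrow> specialization T x z"
  by (auto simp: specialization_iff)

lemma directed_tendsto_meets_open:
  assumes dir: "directed_in (topspace T) (specialization T) D"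
    and lim: "directed_tendsto T D x" and U: "openin T U" "x \<in> U"
  shows "D \<inter> U \<noteq> {}"
proof -
  let ?F = "\<lambda>d. principal {e \<in> D. specialization T d e}"
  have "eventually (\<lambda>e. e \<in> U) (INF d\<in>D. ?F d)"
    using lim U by (auto simp: directed_tendsto_def limitin_def directed_net_def)
  moreover have "\<exists>c\<in>D. ?F c \<le> inf (?F a) (?F b)" if ab: "a \<in> D" "b \<in> D" for a b
  proof -
    obtain c where "c \<in> D" "specialization T a c" "specialization T b c"
      using directed_in_pair[OF dir ab] by auto
    then show ?thesis
      by (intro bexI[of _ c]) (auto intro: specialization_trans)
  qed
  ultimately obtain d where d: "d \<in> D" "eventually (\<lambda>e. e \<in> U) (?F d)"
    using dir by (subst (asm) eventually_INF_base) (auto simp: directed_in_def)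
  moreover have "d \<in> topspace T"
    using d dir by (auto simp: directed_in_def)
  ultimately have "d \<in> U"
    using specialization_refl[of d T] by (auto simp: eventually_principal)
  with d show ?thesis by auto
qed

section \<open>Suprema of continuous valuations\<close>

lemma valuation_le_refl: "valuation_le T \<mu> \<mu>"
  by (simp add: valuation_le_def)

lemma valuation_le_trans:
  "valuation_le T \<mu> \<nu> \<Longrightarrow> valuation_le T \<nu> \<rho> \<Longrightarrow> valuation_le T \<mu> \<rho>"
  unfolding valuation_le_def by (meson order_trans)

lemma transp_on_valuation_le: "transp_on A (valuation_le T)"
  by (auto simp: transp_on_def intro: valuation_le_trans)

lemma continuous_valuation_empty: "\<mu> \<in> continuous_valuations T \<Longrightarrow> \<mu> {} = 0"
  by (simp add: continuous_valuations_def)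

lemma continuous_valuation_mono:
  "\<mu> \<in> continuous_valuations T \<Longrightarrow> openin T U \<Longrightarrow> openin T V \<Longrightarrow> V \<subseteq> U \<Longrightarrow> \<mu> V \<le> \<mu> U"
  unfolding continuous_valuations_def by blast

lemma continuous_valuation_modular:
  "\<mu> \<in> continuous_valuations T \<Longrightarrow> openin T U \<Longrightarrow> openin T V \<Longrightarrow>
     \<mu> U + \<mu> V = \<mu> (U \<union> V) + \<mu> (U \<inter> V)"
  unfolding continuous_valuations_def by blast

lemma continuous_valuation_Union:
  "\<mu> \<in> continuous_valuations T \<Longrightarrow> directed_in {U. openin T U} (\<subseteq>) \<V> \<Longrightarrow>
     \<mu> (\<Union>\<V>) = (SUP U\<in>\<V>. \<mu> U)"
  unfolding continuous_valuations_def by blast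

definition pointwise_SUP :: "'a topology \<Rightarrow> ('a set \<Rightarrow> ennreal) set \<Rightarrow> 'a set \<Rightarrow> ennreal" where
  "pointwise_SUP T \<D> = (\<lambda>U\<in>{U. openin T U}. SUP \<nu>\<in>\<D>. \<nu> U)"

lemma pointwise_SUP_apply: "openin T U \<Longrightarrow> pointwise_SUP T \<D> U = (SUP \<nu>\<in>\<D>. \<nu> U)"
  by (simp add: pointwise_SUP_def)

text \<open>
  Directedness is what makes the supremum commute with the addition in the modular law;
  the continuity condition only exchanges two suprema.
\<close>

lemma pointwise_SUP_in_continuous_valuations:
  assumes dir: "directed_in (continuous_valuations T) (valuation_le T) \<D>"
  shows "pointwise_SUP T \<D> \<in> continuous_valuations T"
proof -
  have val: "\<nu> \<in> continuous_valuations T" if "\<nu> \<in> \<D>" for \<nu>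
    using dir that by (auto simp: directed_in_def)
  have "\<D> \<noteq> {}" using dir by (auto simp: directed_in_def)
  have "pointwise_SUP T \<D> {} = 0"
    unfolding pointwise_SUP_apply[OF openin_empty]
    by (intro SUP_eq_const \<open>\<D> \<noteq> {}\<close> continuous_valuation_empty[OF val])
  moreover have "pointwise_SUP T \<D> V \<le> pointwise_SUP T \<D> U"
    if "openin T U" "openin T V" "V \<subseteq> U" for U V
    unfolding pointwise_SUP_apply[OF that(1)] pointwise_SUP_apply[OF that(2)]
    by (intro SUP_subset_mono subset_refl continuous_valuation_mono[OF val that])
  moreover have "pointwise_SUP T \<D> U + pointwise_SUP T \<D> V =
      pointwise_SUP T \<D> (U \<union> V) + pointwise_SUP T \<D> (U \<inter> V)"
    if U: "openin T U" and V: "openin T V" for U V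
  proof -
    have add: "(SUP \<nu>\<in>\<D>. \<nu> A + \<nu> B) = (SUP \<nu>\<in>\<D>. \<nu> A) + (SUP \<nu>\<in>\<D>. \<nu> B)"
      if "openin T A" "openin T B" for A B
    proof (rule SUP_add_directed_ennreal)
      fix \<mu> \<nu> assume "\<mu> \<in> \<D>" "\<nu> \<in> \<D>"
      then obtain \<rho> where "\<rho> \<in> \<D>" "valuation_le T \<mu> \<rho>" "valuation_le T \<nu> \<rho>"
        using directed_in_pair[OF dir] by blast
      with that show "\<exists>\<rho>\<in>\<D>. \<mu> A + \<nu> B \<le> \<rho> A + \<rho> B"
        by (intro bexI[of _ \<rho>] add_mono) (auto simp: valuation_le_def)
    qed
    have "(SUP \<nu>\<in>\<D>. \<nu> U + \<nu> V) = (SUP \<nu>\<in>\<D>. \<nu> (U \<union> V) + \<nu> (U \<inter> V))"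
      by (intro SUP_cong refl continuous_valuation_modular[OF val U V])
    then show ?thesis
      using U V by (simp add: add pointwise_SUP_apply openin_Un openin_Int)
  qed
  moreover have "pointwise_SUP T \<D> (\<Union>\<V>) = (SUP U\<in>\<V>. pointwise_SUP T \<D> U)"
    if \<V>: "directed_in {U. openin T U} (\<subseteq>) \<V>" for \<V>
  proof -
    have op: "openin T U" if "U \<in> \<V>" for U
      using \<V> that by (auto simp: directed_in_def)
    have "pointwise_SUP T \<D> (\<Union>\<V>) = (SUP \<nu>\<in>\<D>. \<nu> (\<Union>\<V>))"
      using op by (intro pointwise_SUP_apply openin_Union) auto
    also have "\<dots> = (SUP \<nu>\<in>\<D>. SUP U\<in>\<V>. \<nu> U)"
      by (intro SUP_cong refl continuous_valuation_Union[OF val \<V>])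
    also have "\<dots> = (SUP U\<in>\<V>. SUP \<nu>\<in>\<D>. \<nu> U)"
      by (rule SUP_commute)
    also have "\<dots> = (SUP U\<in>\<V>. pointwise_SUP T \<D> U)"
      using op by (intro SUP_cong) (auto simp: pointwise_SUP_apply)
    finally show ?thesis .
  qed
  moreover have "pointwise_SUP T \<D> \<in> extensional {U. openin T U}"
    by (simp add: pointwise_SUP_def)
  ultimately show ?thesis
    unfolding continuous_valuations_def by blast
qed

lemma is_sup_pointwise_SUP:
  assumes "directed_in (continuous_valuations T) (valuation_le T) \<D>"
  shows "is_sup_in (continuous_valuations T) (valuation_le T) \<D> (pointwise_SUP T \<D>)"
  using pointwise_SUP_in_continuous_valuations[OF assms]
  by (auto simp: is_sup_in_def valuation_le_def pointwise_SUP_apply intro: SUP_upper SUP_least)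

lemma is_sup_in_le_pointwise_SUP:
  assumes "directed_in (continuous_valuations T) (valuation_le T) \<D>"
    and "is_sup_in (continuous_valuations T) (valuation_le T) \<D> \<mu>"
  shows "valuation_le T \<mu> (pointwise_SUP T \<D>)"
  using is_sup_pointwise_SUP[OF assms(1)] assms(2) unfolding is_sup_in_def by blast

section \<open>Finite sums of point masses\<close>

text \<open>
  Unlike a simple valuation in normal form, the sum is indexed by \<open>B\<close> and not by its support,
  so the points \<open>d b\<close> can be moved independently and may collide.
\<close>

definition dirac_sum ::
    "'a topology \<Rightarrow> 'b set \<Rightarrow> ('b \<Rightarrow> real) \<Rightarrow> ('b \<Rightarrow> 'a) \<Rightarrow> 'a set \<Rightarrow> ennreal" where
  "dirac_sum T B s d = (\<lambda>U\<in>{U. openin T U}. \<Sum>b\<in>B. ennreal (s b) * indicator U (d b))"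

lemma simple_valuation_eq_dirac_sum: "simple_valuation T B r = dirac_sum T B r (\<lambda>b. b)"
  by (simp add: simple_valuation_def dirac_sum_def)

lemma dirac_sum_apply:
  assumes "finite B" "\<And>b. b \<in> B \<Longrightarrow> 0 \<le> s b" "openin T U"
  shows "dirac_sum T B s d U = ennreal (\<Sum>b\<in>B. s b * indicator U (d b))"
proof -
  have "(\<Sum>b\<in>B. ennreal (s b) * indicator U (d b)) = (\<Sum>b\<in>B. ennreal (s b * indicator U (d b)))"
    by (intro sum.cong) (auto simp: indicator_def)
  also have "\<dots> = ennreal (\<Sum>b\<in>B. s b * indicator U (d b))"
    using assms by (intro sum_ennreal) auto
  finally show ?thesis using assms by (simp add: dirac_sum_def)
qed

lemma dirac_sum_in_simple_valuations:
  assumes "finite B" "\<And>b. b \<in> B \<Longrightarrow> 0 < s b" "\<And>b. b \<in> B \<Longrightarrow> d b \<in> topspace T"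
  shows "dirac_sum T B s d \<in> simple_valuations T"
proof -
  \<comment> \<open>Colliding points are merged, adding their weights.\<close>
  define r where "r c = (\<Sum>b\<in>{b \<in> B. d b = c}. s b)" for c
  have "(\<Sum>b\<in>B. ennreal (s b) * indicator U (d b)) = (\<Sum>c\<in>d ` B. ennreal (r c) * indicator U c)" for U
  proof -
    have "(\<Sum>b\<in>B. ennreal (s b) * indicator U (d b)) =
        (\<Sum>c\<in>d ` B. \<Sum>b\<in>{b \<in> B. d b = c}. ennreal (s b) * indicator U (d b))"
      using assms(1) by (rule sum.image_gen)
    also have "\<dots> = (\<Sum>c\<in>d ` B. ennreal (r c) * indicator U c)"
    proof (rule sum.cong[OF refl])
      fix c
      have "ennreal (r c) = (\<Sum>b\<in>{b \<in> B. d b = c}. ennreal (s b))"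
        unfolding r_def using assms(2) by (subst sum_ennreal) (auto simp: less_imp_le)
      then show "(\<Sum>b\<in>{b \<in> B. d b = c}. ennreal (s b) * indicator U (d b)) =
          ennreal (r c) * indicator U c"
        by (simp add: sum_distrib_right)
    qed
    finally show ?thesis .
  qed
  then have "dirac_sum T B s d = simple_valuation T (d ` B) r"
    by (simp add: dirac_sum_def simple_valuation_def)
  moreover have "is_simple_rep T (d ` B) r"
    using assms by (auto simp: is_simple_rep_def r_def intro!: sum_pos)
  ultimately show ?thesis
    unfolding simple_valuations_def by blast
qed

text \<open>
  Continuity holds because only finitely many point masses are involved: those in a directed
  union of open sets all lie in a single member of the family.
\<close>

lemma simple_valuations_subset_continuous: "simple_valuations T \<subseteq> continuous_valuations T"
proof
  fix \<xi> assume "\<xi> \<in> simple_valuations T"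
  then obtain B r where B: "finite B" and \<xi>: "\<xi> = simple_valuation T B r"
    by (auto simp: simple_valuations_def is_simple_rep_def)
  have app: "\<xi> U = (\<Sum>b\<in>B. ennreal (r b) * indicator U b)" if "openin T U" for U
    using that by (simp add: \<xi> simple_valuation_def)
  have mono: "\<xi> V \<le> \<xi> U" if "openin T U" "openin T V" "V \<subseteq> U" for U V
    using that by (auto simp: app indicator_def intro!: sum_mono)
  have "\<xi> U + \<xi> V = \<xi> (U \<union> V) + \<xi> (U \<inter> V)" if "openin T U" "openin T V" for U V
  proof -
    have "ennreal (r b) * indicator U b + ennreal (r b) * indicator V b =
        ennreal (r b) * indicator (U \<union> V) b + ennreal (r b) * indicator (U \<inter> V) b" for b
      by (auto simp: indicator_def)
    then show ?thesis
      using that by (simp add: app openin_Un openin_Int flip: sum.distrib)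
  qed
  moreover have "\<xi> (\<Union>\<V>) = (SUP U\<in>\<V>. \<xi> U)" if \<V>: "directed_in {U. openin T U} (\<subseteq>) \<V>" for \<V>
  proof (rule antisym)
    have op: "openin T U" if "U \<in> \<V>" for U
      using \<V> that by (auto simp: directed_in_def)
    then have opU: "openin T (\<Union>\<V>)" by auto
    have "\<forall>b\<in>B \<inter> \<Union>\<V>. \<exists>V\<in>\<V>. b \<in> V" by auto
    then obtain V where V: "\<And>b. b \<in> B \<inter> \<Union>\<V> \<Longrightarrow> V b \<in> \<V> \<and> b \<in> V b" by metis
    obtain W where W: "W \<in> \<V>" "B \<inter> \<Union>\<V> \<subseteq> W"
    proof (cases "B \<inter> \<Union>\<V> = {}")
      case True
      with \<V> that show ?thesis by (auto simp: directed_in_def)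
    next
      case False
      then have "V ` (B \<inter> \<Union>\<V>) \<subseteq> \<V> \<and> finite (V ` (B \<inter> \<Union>\<V>)) \<and> V ` (B \<inter> \<Union>\<V>) \<noteq> {}"
        using V B by blast
      then obtain W where "W \<in> \<V>" "\<forall>A\<in>V ` (B \<inter> \<Union>\<V>). A \<subseteq> W"
        using \<V> unfolding directed_in_def by meson
      with V that show ?thesis by blast
    qed
    have "\<xi> (\<Union>\<V>) = \<xi> W"
      unfolding app[OF opU] app[OF op[OF W(1)]]
      using W by (intro sum.cong) (auto simp: indicator_def)
    also have "\<dots> \<le> (SUP U\<in>\<V>. \<xi> U)" using W by (intro SUP_upper)
    finally show "\<xi> (\<Union>\<V>) \<le> (SUP U\<in>\<V>. \<xi> U)" .
    show "(SUP U\<in>\<V>. \<xi> U) \<le> \<xi> (\<Union>\<V>)"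
      using op opU by (intro SUP_least mono) auto
  qed
  moreover have "\<xi> {} = 0" by (simp add: app)
  moreover have "\<xi> \<in> extensional {U. openin T U}" by (simp add: \<xi> simple_valuation_def)
  ultimately show "\<xi> \<in> continuous_valuations T"
    using mono unfolding continuous_valuations_def by blast
qed

section \<open>Scott open sets of valuations are open for the convergence\<close>

text \<open>
  The weights of \<open>\<xi>\<close> are only approached from below; they are scaled by a factor \<open>t < 1\<close>, and
  \<open>t\<close> tends to \<open>1\<close>.
\<close>

lemma P_converges_le_pointwise_SUP:
  assumes conv: "P_converges T \<D> \<xi>"
  shows "valuation_le T \<xi> (pointwise_SUP T \<D>)"
  unfolding valuation_le_def
proof (intro allI impI)
  fix U assume U: "openin T U"
  obtain B r D where rep: "is_simple_rep T B r" and \<xi>: "\<xi> = simple_valuation T B r"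
    and D: "\<forall>b\<in>B. directed_in (topspace T) (specialization T) (D b) \<and> directed_tendsto T (D b) b"
    and approx: "\<forall>d\<in>Pi B D. \<forall>r'. (\<forall>b\<in>B. r' b < r b) \<longrightarrow>
      (\<exists>\<xi>'\<in>\<D>. \<forall>U. openin T U \<longrightarrow>
        ereal (\<Sum>b\<in>B. r' b * indicator U (d b)) \<le> enn2ereal (\<xi>' U))"
    using conv unfolding P_converges_def by (elim exE conjE) (rule that)
  have B: "finite B" and r: "\<And>b. b \<in> B \<Longrightarrow> 0 < r b"
    using rep by (auto simp: is_simple_rep_def)
  have "\<exists>e\<in>D b. b \<in> U \<longrightarrow> e \<in> U" if "b \<in> B" for b
  proof -
    have dir: "directed_in (topspace T) (specialization T) (D b)" and lim: "directed_tendsto T (D b) b"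
      using D that by auto
    have "D b \<noteq> {}" using dir by (simp add: directed_in_def)
    then show ?thesis using directed_tendsto_meets_open[OF dir lim U] by blast
  qed
  then obtain d where d: "\<And>b. b \<in> B \<Longrightarrow> d b \<in> D b \<and> (b \<in> U \<longrightarrow> d b \<in> U)"
    by metis
  let ?m = "SUP \<nu>\<in>\<D>. \<nu> U" and ?c = "\<Sum>b\<in>B. r b * indicator U b"
  have "ennreal ?c \<le> ?m"
  proof (cases ?m)
    case (real m)
    have "?c \<le> m"
    proof (rule field_le_mult_one_interval)
      fix t :: real assume t: "0 < t" "t < 1"
      have "d \<in> Pi B D" using d by auto
      moreover have "\<forall>b\<in>B. t * r b < r b" using r t by auto
      ultimately obtain \<xi>' where \<xi>': "\<xi>' \<in> \<D>"
        and le: "ereal (\<Sum>b\<in>B. (t * r b) * indicator U (d b)) \<le> enn2ereal (\<xi>' U)"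
        using approx[rule_format, of d "\<lambda>b. t * r b"] U by blast
      have "t * ?c = (\<Sum>b\<in>B. (t * r b) * indicator U b)"
        by (simp add: sum_distrib_left mult.assoc)
      also have "\<dots> \<le> (\<Sum>b\<in>B. (t * r b) * indicator U (d b))"
        using d r t by (intro sum_mono mult_left_mono) (auto simp: indicator_def less_imp_le)
      finally have "ereal (t * ?c) \<le> ereal (\<Sum>b\<in>B. (t * r b) * indicator U (d b))" by simp
      also note le
      also have "enn2ereal (\<xi>' U) \<le> enn2ereal ?m"
        unfolding less_eq_ennreal.rep_eq[symmetric] using \<xi>' by (rule SUP_upper)
      also have "\<dots> = ereal m" using real by simp
      finally show "t * ?c \<le> m" by simp
    qed
    then show ?thesis using real by (simp add: ennreal_leI)
  next
    case top
    then show ?thesis by (simp only: top_greatest)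
  qed
  moreover have "\<xi> U = ennreal ?c"
    using dirac_sum_apply[of B r T U "\<lambda>b. b"] B r U
    by (simp add: \<xi> simple_valuation_eq_dirac_sum less_imp_le)
  ultimately show "\<xi> U \<le> pointwise_SUP T \<D> U"
    using U by (simp add: pointwise_SUP_apply)
qed

lemma scott_open_Int_simple_in_P_opens:
  assumes W: "scott_open (continuous_valuations T) (valuation_le T) \<W>"
  shows "\<W> \<inter> simple_valuations T \<in> P_opens T"
  unfolding P_opens_def
proof (intro CollectI conjI allI impI)
  fix \<D> \<xi>
  assume *: "directed_in (simple_valuations T) (valuation_le T) \<D> \<and>
    P_converges T \<D> \<xi> \<and> \<xi> \<in> \<W> \<inter> simple_valuations T"
  then have sub: "\<D> \<subseteq> simple_valuations T" by (simp add: directed_in_def)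
  then have "\<D> \<subseteq> continuous_valuations T"
    using simple_valuations_subset_continuous by (rule order_trans)
  with * have dir: "directed_in (continuous_valuations T) (valuation_le T) \<D>"
    by (simp add: directed_in_def)
  have "valuation_le T \<xi> (pointwise_SUP T \<D>)"
    using * P_converges_le_pointwise_SUP by blast
  then have "pointwise_SUP T \<D> \<in> \<W>"
    using W * pointwise_SUP_in_continuous_valuations[OF dir]
    unfolding scott_open_def by blast
  with W dir is_sup_pointwise_SUP[OF dir] have "\<W> \<inter> \<D> \<noteq> {}"
    unfolding scott_open_def by blast
  with sub show "\<D> \<inter> (\<W> \<inter> simple_valuations T) \<noteq> {}" by blast
qed simp

section \<open>Continuous domains\<close>

lemma topspace_scott_topology: "topspace (scott_topology X le) = X"
proof -
  have "scott_open X le X" by (auto simp: scott_open_def directed_in_def)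
  then show ?thesis
    unfolding topspace_def openin_scott_topology by (auto simp: scott_open_def)
qed

lemma scott_open_not_below:
  assumes "poset_on X le" "y \<in> X"
  shows "scott_open X le {z \<in> X. \<not> le z y}"
  unfolding scott_open_def
proof (intro conjI ballI allI impI)
  fix x z assume "x \<in> {z \<in> X. \<not> le z y}" "z \<in> X" "le x z"
  then show "z \<in> {z \<in> X. \<not> le z y}"
    using assms transp_onD[of X le x z y] by (auto simp: poset_on_def)
next
  fix D s assume *: "directed_in X le D \<and> is_sup_in X le D s \<and> s \<in> {z \<in> X. \<not> le z y}"
  then have "\<exists>d\<in>D. \<not> le d y" using assms(2) by (auto simp: is_sup_in_def)
  with * show "{z \<in> X. \<not> le z y} \<inter> D \<noteq> {}" by (auto simp: directed_in_def)
qed auto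

lemma specialization_scott_topology:
  assumes "poset_on X le" "x \<in> X" "y \<in> X"
  shows "specialization (scott_topology X le) x y \<longleftrightarrow> le x y"
proof
  assume "specialization (scott_topology X le) x y"
  then have "x \<in> {z \<in> X. \<not> le z y} \<Longrightarrow> y \<in> {z \<in> X. \<not> le z y}"
    using scott_open_not_below[OF assms(1,3)]
    unfolding specialization_iff openin_scott_topology by blast
  moreover have "le y y" using assms by (auto simp: poset_on_def reflp_on_def)
  ultimately show "le x y" using assms by auto
next
  assume "le x y"
  then show "specialization (scott_topology X le) x y"
    using assms unfolding specialization_iff topspace_scott_topology openin_scott_topology
    by (auto simp: scott_open_def)
qed

lemma way_below_imp_le:
  assumes "poset_on X le" "way_below X le x y"
  shows "le x y"
proof -
  have xy: "x \<in> X" "y \<in> X" using assms by (auto simp: way_below_def)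
  then have "le y y" using assms by (auto simp: poset_on_def reflp_on_def)
  then have "directed_in X le {y}" "is_sup_in X le {y} y"
    using xy by (auto simp: directed_in_def is_sup_in_def)
  with \<open>le y y\<close> assms(2) show ?thesis unfolding way_below_def by blast
qed

lemma way_below_mono:
  assumes "poset_on X le" "le x' x" "way_below X le x y" "le y y'" "x' \<in> X" "y' \<in> X"
  shows "way_below X le x' y'"
  unfolding way_below_def
proof (intro conjI allI impI)
  have xy: "x \<in> X" "y \<in> X" using assms by (auto simp: way_below_def)
  have tr: "transp_on X le" using assms by (auto simp: poset_on_def)
  fix D s assume *: "directed_in X le D \<and> is_sup_in X le D s \<and> le y' s"
  then have "le y s" using transp_onD[OF tr, of y y' s] xy assms by (auto simp: is_sup_in_def)
  with * obtain d where d: "d \<in> D" "le x d" using assms(3) unfolding way_below_def by blast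
  then have "le x' d"
    using transp_onD[OF tr, of x' x d] xy assms * by (auto simp: directed_in_def)
  with d show "\<exists>d\<in>D. le x' d" by blast
qed (use assms in auto)

lemma continuous_domain_poset: "continuous_domain X le \<Longrightarrow> poset_on X le"
  by (simp add: continuous_domain_def dcpo_on_def)

lemma way_below_directed:
  "continuous_domain X le \<Longrightarrow> x \<in> X \<Longrightarrow> directed_in X le {a. way_below X le a x}"
  by (simp add: continuous_domain_def)

lemma way_below_sup:
  "continuous_domain X le \<Longrightarrow> x \<in> X \<Longrightarrow> is_sup_in X le {a. way_below X le a x} x"
  by (simp add: continuous_domain_def)

text \<open>
  The elements two way-below steps under \<open>x\<close> already form a directed set with supremum \<open>x\<close>,
  so everything way below \<open>x\<close> is below one of them.
\<close>

lemma way_below_interpolation: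
  assumes cd: "continuous_domain X le" and ax: "way_below X le a x"
  shows "\<exists>y. way_below X le a y \<and> way_below X le y x"
proof -
  note po = continuous_domain_poset[OF cd]
  have tr: "transp_on X le" and re: "\<And>z. z \<in> X \<Longrightarrow> le z z"
    using po by (auto simp: poset_on_def reflp_on_def)
  have X: "a \<in> X" "x \<in> X" using ax by (auto simp: way_below_def)
  define E where "E = {e. \<exists>y. way_below X le e y \<and> way_below X le y x}"
  have "directed_in X le E"
  proof (rule directed_inI_pairwise[OF _ _ tr])
    show "E \<subseteq> X" by (auto simp: E_def way_below_def)
    obtain y where y: "way_below X le y x"
      using way_below_directed[OF cd X(2)] by (auto simp: directed_in_def)
    then have "y \<in> X" by (auto simp: way_below_def)
    then have "{a. way_below X le a y} \<noteq> {}"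
      using way_below_directed[OF cd, of y] by (simp add: directed_in_def)
    then show "E \<noteq> {}" using y unfolding E_def by blast
  next
    fix e1 e2 assume "e1 \<in> E" "e2 \<in> E"
    then obtain y1 y2 where y: "way_below X le e1 y1" "way_below X le y1 x"
      "way_below X le e2 y2" "way_below X le y2 x" by (auto simp: E_def)
    then obtain y where y': "way_below X le y x" "le y1 y" "le y2 y"
      using directed_in_pair[OF way_below_directed[OF cd X(2)], of y1 y2] by blast
    have in_X: "e1 \<in> X" "e2 \<in> X" "y \<in> X" using y y' by (auto simp: way_below_def)
    have "way_below X le e1 y"
      by (rule way_below_mono[OF po re[OF in_X(1)] y(1) y'(2) in_X(1) in_X(3)])
    moreover have "way_below X le e2 y"
      by (rule way_below_mono[OF po re[OF in_X(2)] y(3) y'(3) in_X(2) in_X(3)])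
    ultimately obtain u where "way_below X le u y" "le e1 u" "le e2 u"
      using directed_in_pair[OF way_below_directed[OF cd in_X(3)], of e1 e2] by blast
    then show "\<exists>u\<in>E. le e1 u \<and> le e2 u"
      using y' unfolding E_def by blast
  qed
  moreover have "is_sup_in X le E x"
    unfolding is_sup_in_def
  proof (intro conjI ballI impI)
    fix e assume "e \<in> E"
    then obtain y where y: "way_below X le e y" "way_below X le y x" unfolding E_def by blast
    then have "e \<in> X" "y \<in> X" by (simp_all add: way_below_def)
    then show "le e x"
      using transp_onD[OF tr, of e y x] X way_below_imp_le[OF po y(1)] way_below_imp_le[OF po y(2)]
      by blast
  next
    fix u assume u: "u \<in> X" "\<forall>d\<in>E. le d u"
    have "le y u" if y: "way_below X le y x" for y
    proof -
      have "y \<in> X" using y by (auto simp: way_below_def)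
      moreover have "le e u" if "way_below X le e y" for e
        using that y u unfolding E_def by blast
      ultimately show ?thesis
        using way_below_sup[OF cd, of y] u(1) unfolding is_sup_in_def by blast
    qed
    then show "le x u" using way_below_sup[OF cd X(2)] u(1) unfolding is_sup_in_def by blast
  qed (rule X)
  ultimately obtain e where e: "e \<in> E" "le a e"
    using ax re[OF X(2)] unfolding way_below_def by blast
  then obtain y where y: "way_below X le e y" "way_below X le y x" unfolding E_def by blast
  then have "y \<in> X" by (simp add: way_below_def)
  then have "way_below X le a y"
    by (intro way_below_mono[OF po e(2) y(1)] re X)
  with y show ?thesis by blast
qed

lemma scott_open_way_above:
  assumes cd: "continuous_domain X le"
  shows "scott_open X le {x. way_below X le a x}"
  unfolding scott_open_def
proof (intro conjI ballI allI impI)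
  note po = continuous_domain_poset[OF cd]
  have re: "\<And>z. z \<in> X \<Longrightarrow> le z z"
    using po by (auto simp: poset_on_def reflp_on_def)
  show "y \<in> {x. way_below X le a x}" if "x \<in> {x. way_below X le a x}" "y \<in> X" "le x y" for x y
    using that way_below_mono[OF po re, of a x y] by (auto simp: way_below_def)
  fix D s assume *: "directed_in X le D \<and> is_sup_in X le D s \<and> s \<in> {x. way_below X le a x}"
  then obtain y where y: "way_below X le a y" "way_below X le y s"
    using way_below_interpolation[OF cd] by blast
  with * obtain d where d: "d \<in> D" "le y d"
    using re unfolding way_below_def by blast
  have "a \<in> X" "d \<in> X"
    using y d * by (auto simp: way_below_def directed_in_def)
  then have "way_below X le a d"
    by (intro way_below_mono[OF po re y(1) d(2)])
  with d show "{x. way_below X le a x} \<inter> D \<noteq> {}" by blast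
qed (auto simp: way_below_def)

lemma way_below_directed_tendsto:
  assumes cd: "continuous_domain X le" and T: "T = scott_topology X le" and x: "x \<in> X"
  shows "directed_in (topspace T) (specialization T) {a. way_below X le a x}"
    and "directed_tendsto T {a. way_below X le a x} x"
proof -
  let ?D = "{a. way_below X le a x}"
  note spec = specialization_scott_topology[OF continuous_domain_poset[OF cd]]
  note dir = way_below_directed[OF cd x]
  show "directed_in (topspace T) (specialization T) ?D"
  proof (rule directed_inI_pairwise)
    show "transp_on (topspace T) (specialization T)"
      by (auto simp: transp_on_def intro: specialization_trans)
    fix a b assume ab: "a \<in> ?D" "b \<in> ?D"
    then obtain u where u: "u \<in> ?D" "le a u" "le b u"
      using directed_in_pair[OF dir] by blast
    then have "specialization T a u" "specialization T b u"
      using ab by (simp_all add: T spec way_below_def)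
    then show "\<exists>u\<in>?D. specialization T a u \<and> specialization T b u" using u by blast
  qed (use dir in \<open>auto simp: T topspace_scott_topology directed_in_def\<close>)
  show "directed_tendsto T ?D x"
    unfolding directed_tendsto_def limitin_def
  proof (intro conjI allI impI)
    show "x \<in> topspace T" by (simp add: T topspace_scott_topology x)
    fix U assume U: "openin T U \<and> x \<in> U"
    then have "U \<inter> ?D \<noteq> {}"
      using dir way_below_sup[OF cd x] unfolding T openin_scott_topology scott_open_def by blast
    then obtain a where a: "a \<in> ?D" "a \<in> U" by blast
    have "eventually (\<lambda>e. e \<in> U) (principal {e \<in> ?D. specialization T a e})"
      using a U by (auto simp: eventually_principal specialization_iff)
    then show "eventually (\<lambda>e. e \<in> U) (directed_net T ?D)"
      unfolding directed_net_def using a(1) by (rule eventually_INF1[rotated])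
  qed
qed

section \<open>Lowering a simple valuation inside an open set\<close>

text \<open>
  On an open set \<open>U\<close> the lowered sum only sees \<open>J = {b \<in> B. d b \<in> U}\<close>, and \<open>U\<close> contains the open
  set \<open>\<Union>b\<in>J. {x. d b \<lless> x}\<close>, which contains \<open>J\<close>.  So it is enough to dominate the lowered sum
  on these open sets; there are only finitely many, one for each \<open>J \<subseteq> B\<close>, and on each of
  them the weights increase strictly unless \<open>J\<close> is empty.
\<close>

lemma way_below_dirac_sum:
  assumes cd: "continuous_domain X le" and T: "T = scott_topology X le"
    and B: "finite B" "B \<subseteq> X"
    and s: "\<And>b. b \<in> B \<Longrightarrow> 0 < s b \<and> s b < r b"
    and d: "\<And>b. b \<in> B \<Longrightarrow> way_below X le (d b) b"
  shows "way_below (continuous_valuations T) (valuation_le T)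
           (dirac_sum T B s d) (simple_valuation T B r)"
proof -
  have r_pos: "0 < r b" if "b \<in> B" for b
    using s[OF that] by linarith
  have "d b \<in> topspace T" if "b \<in> B" for b
    using d[OF that] by (auto simp: T topspace_scott_topology way_below_def)
  then have "dirac_sum T B s d \<in> continuous_valuations T"
    using dirac_sum_in_simple_valuations[of B s d T] B s simple_valuations_subset_continuous
    by blast
  moreover have "is_simple_rep T B r"
    using B r_pos by (simp add: is_simple_rep_def T topspace_scott_topology)
  then have "simple_valuation T B r \<in> continuous_valuations T"
    using simple_valuations_subset_continuous unfolding simple_valuations_def by blast
  moreover have "\<exists>\<nu>\<in>\<D>. valuation_le T (dirac_sum T B s d) \<nu>"
    if dir: "directed_in (continuous_valuations T) (valuation_le T) \<D>"
      and sup: "is_sup_in (continuous_valuations T) (valuation_le T) \<D> \<mu>"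
      and le: "valuation_le T (simple_valuation T B r) \<mu>" for \<D> \<mu>
  proof -
    define A where "A J = (\<Union>b\<in>J. {x. way_below X le (d b) x})" for J
    have A_open: "openin T (A J)" for J
      unfolding A_def using scott_open_way_above[OF cd]
      by (intro openin_Union) (auto simp: T openin_scott_topology)
    have "\<exists>\<nu>\<in>\<D>. ennreal (\<Sum>b\<in>J. s b) \<le> \<nu> (A J)" if J: "J \<subseteq> B" for J
    proof (cases "J = {}")
      case True
      then show ?thesis using dir by (auto simp: directed_in_def)
    next
      case False
      have fJ: "finite J" using J B finite_subset by blast
      have "ennreal (\<Sum>b\<in>J. s b) < ennreal (\<Sum>b\<in>J. r b)"
      proof (rule ennreal_lessI)
        show "(\<Sum>b\<in>J. s b) < (\<Sum>b\<in>J. r b)"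
          using fJ False J s by (intro sum_strict_mono) auto
        show "0 < (\<Sum>b\<in>J. r b)"
          using fJ False J r_pos by (intro sum_pos) auto
      qed
      also have "(\<Sum>b\<in>J. r b) = (\<Sum>b\<in>J. r b * indicator (A J) b)"
        using d J by (intro sum.cong) (auto simp: A_def indicator_def)
      also have "ennreal \<dots> \<le> ennreal (\<Sum>b\<in>B. r b * indicator (A J) b)"
      proof (intro ennreal_leI sum_mono2)
        fix b assume "b \<in> B - J"
        then show "0 \<le> r b * indicator (A J) b" using r_pos[of b] by simp
      qed (use B J in auto)
      also have "\<dots> = simple_valuation T B r (A J)"
        unfolding simple_valuation_eq_dirac_sum
        using r_pos B A_open by (intro dirac_sum_apply[symmetric]) (auto simp: less_imp_le)
      also have "\<dots> \<le> \<mu> (A J)" using le A_open by (simp add: valuation_le_def)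
      also have "\<dots> \<le> pointwise_SUP T \<D> (A J)"
        using is_sup_in_le_pointwise_SUP[OF dir sup] A_open unfolding valuation_le_def by blast
      also have "\<dots> = (SUP \<nu>\<in>\<D>. \<nu> (A J))"
        by (rule pointwise_SUP_apply[OF A_open])
      finally show ?thesis unfolding less_SUP_iff by (blast intro: less_imp_le)
    qed
    then have "\<forall>J\<in>Pow B. \<exists>\<nu>. \<nu> \<in> \<D> \<and> ennreal (\<Sum>b\<in>J. s b) \<le> \<nu> (A J)" by blast
    then obtain N where N: "\<forall>J\<in>Pow B. N J \<in> \<D> \<and> ennreal (\<Sum>b\<in>J. s b) \<le> N J (A J)"
      by (rule bchoice[THEN exE])
    then have "N ` Pow B \<subseteq> \<D> \<and> finite (N ` Pow B) \<and> N ` Pow B \<noteq> {}"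
      using B by blast
    then obtain \<nu> where \<nu>: "\<nu> \<in> \<D>" "\<forall>\<rho>\<in>N ` Pow B. valuation_le T \<rho> \<nu>"
      using dir unfolding directed_in_def by meson
    have "dirac_sum T B s d U \<le> \<nu> U" if U: "openin T U" for U
    proof -
      let ?J = "{b \<in> B. d b \<in> U}"
      have "dirac_sum T B s d U = ennreal (\<Sum>b\<in>B. s b * indicator U (d b))"
        using s B U by (intro dirac_sum_apply) (auto simp: less_imp_le)
      also have "(\<Sum>b\<in>B. s b * indicator U (d b)) = (\<Sum>b\<in>?J. s b)"
        using B by (intro sum.mono_neutral_cong_right) (auto simp: indicator_def)
      also have "ennreal \<dots> \<le> N ?J (A ?J)" using N by blast
      also have "\<dots> \<le> \<nu> (A ?J)"
        using \<nu>(2) A_open[of ?J] unfolding valuation_le_def by blast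
      also have "\<dots> \<le> \<nu> U"
      proof -
        have "A ?J \<subseteq> U"
          using U way_below_imp_le[OF continuous_domain_poset[OF cd]]
          unfolding A_def T openin_scott_topology scott_open_def way_below_def by blast
        moreover have "\<nu> \<in> continuous_valuations T"
          using \<nu> dir by (auto simp: directed_in_def)
        ultimately show ?thesis
          using U A_open continuous_valuation_mono by blast
      qed
      finally show ?thesis .
    qed
    with \<nu>(1) show ?thesis unfolding valuation_le_def by blast
  qed
  ultimately show ?thesis
    unfolding way_below_def by blast
qed

definition lower_dirac_sums ::
    "'a set \<Rightarrow> ('a \<Rightarrow> 'a \<Rightarrow> bool) \<Rightarrow> 'a set \<Rightarrow> ('a \<Rightarrow> real) \<Rightarrow> ('a set \<Rightarrow> ennreal) set" where
  "lower_dirac_sums X le B r =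
     {dirac_sum (scott_topology X le) B s d | s d.
        \<forall>b\<in>B. 0 < s b \<and> s b < r b \<and> way_below X le (d b) b}"

text \<open>
  Two such sums have an upper bound built termwise: the larger weight at each \<open>b\<close>, and an upper
  bound of the two points inside the directed set of elements way below \<open>b\<close>.
\<close>

lemma directed_lower_dirac_sums:
  assumes cd: "continuous_domain X le" and T: "T = scott_topology X le"
    and B: "is_simple_rep T B r"
  shows "directed_in (simple_valuations T) (valuation_le T) (lower_dirac_sums X le B r)"
proof (rule directed_inI_pairwise[OF _ _ transp_on_valuation_le])
  have fB: "finite B" and BX: "B \<subseteq> X" and r: "\<And>b. b \<in> B \<Longrightarrow> 0 < r b"
    using B by (auto simp: is_simple_rep_def T topspace_scott_topology)
  note dir = way_below_directed[OF cd]
  show "lower_dirac_sums X le B r \<subseteq> simple_valuations T"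
    unfolding lower_dirac_sums_def using fB
    by (auto simp: T topspace_scott_topology way_below_def
        intro!: dirac_sum_in_simple_valuations)
  have "\<forall>b\<in>B. \<exists>a. way_below X le a b"
    using dir BX unfolding directed_in_def by blast
  then obtain d where "\<forall>b\<in>B. way_below X le (d b) b" by metis
  then have "dirac_sum T B (\<lambda>b. r b / 2) d \<in> lower_dirac_sums X le B r"
    unfolding lower_dirac_sums_def T using r
    by (intro CollectI exI[of _ "\<lambda>b. r b / 2"] exI[of _ d]) auto
  then show "lower_dirac_sums X le B r \<noteq> {}" by blast
  fix x y assume "x \<in> lower_dirac_sums X le B r" "y \<in> lower_dirac_sums X le B r"
  then obtain s1 d1 s2 d2 where x: "x = dirac_sum T B s1 d1" and y: "y = dirac_sum T B s2 d2"
    and 1: "\<And>b. b \<in> B \<Longrightarrow> 0 < s1 b \<and> s1 b < r b \<and> way_below X le (d1 b) b"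
    and 2: "\<And>b. b \<in> B \<Longrightarrow> 0 < s2 b \<and> s2 b < r b \<and> way_below X le (d2 b) b"
    unfolding lower_dirac_sums_def T by blast
  have "\<forall>b\<in>B. \<exists>e. way_below X le e b \<and> le (d1 b) e \<and> le (d2 b) e"
    using directed_in_pair[OF dir] 1 2 BX by blast
  then obtain d where d: "\<And>b. b \<in> B \<Longrightarrow> way_below X le (d b) b \<and> le (d1 b) (d b) \<and> le (d2 b) (d b)"
    by metis
  define s where "s b = max (s1 b) (s2 b)" for b
  have "dirac_sum T B s d \<in> lower_dirac_sums X le B r"
    unfolding lower_dirac_sums_def T using 1 2 d
    by (intro CollectI exI[of _ s] exI[of _ d]) (auto simp: s_def less_max_iff_disj)
  moreover have "valuation_le T (dirac_sum T B s' d') (dirac_sum T B s d)"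
    if le: "\<And>b. b \<in> B \<Longrightarrow> s' b \<le> s b" "\<And>b. b \<in> B \<Longrightarrow> le (d' b) (d b)" for s' d'
    unfolding valuation_le_def
  proof (intro allI impI)
    fix U assume U: "openin T U"
    then have "d b \<in> U" if "b \<in> B" "d' b \<in> U" for b
      using that le(2) d[of b] unfolding T openin_scott_topology scott_open_def
      by (auto simp: way_below_def)
    then show "dirac_sum T B s' d' U \<le> dirac_sum T B s d U"
      using U le(1) by (auto simp: dirac_sum_def indicator_def intro!: sum_mono ennreal_leI)
  qed
  ultimately show "\<exists>u\<in>lower_dirac_sums X le B r. valuation_le T x u \<and> valuation_le T y u"
    using d unfolding x y by (intro bexI[of _ "dirac_sum T B s d"] conjI) (auto simp: s_def)
qed

lemma P_converges_lower_dirac_sums: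
  assumes cd: "continuous_domain X le" and T: "T = scott_topology X le"
    and B: "is_simple_rep T B r"
  shows "P_converges T (lower_dirac_sums X le B r) (simple_valuation T B r)"
proof -
  have fB: "finite B" and BX: "B \<subseteq> X" and r: "\<And>b. b \<in> B \<Longrightarrow> 0 < r b"
    using B by (auto simp: is_simple_rep_def T topspace_scott_topology)
  let ?D = "\<lambda>b. {a. way_below X le a b}"
  have "\<exists>\<xi>'\<in>lower_dirac_sums X le B r. \<forall>U. openin T U \<longrightarrow>
      ereal (\<Sum>b\<in>B. r' b * indicator U (d b)) \<le> enn2ereal (\<xi>' U)"
    if d: "d \<in> Pi B ?D" and r': "\<forall>b\<in>B. r' b < r b" for d r'
  proof -
    \<comment> \<open>The weights \<open>r' b\<close> may be negative or zero; raise them to positive ones below \<open>r b\<close>.\<close>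
    define s where "s b = max (r' b) (r b / 2)" for b
    have s: "\<And>b. b \<in> B \<Longrightarrow> 0 < s b \<and> s b < r b"
      using r r' by (auto simp: s_def less_max_iff_disj)
    have "dirac_sum T B s d \<in> lower_dirac_sums X le B r"
      unfolding lower_dirac_sums_def T using s d by auto
    moreover have "ereal (\<Sum>b\<in>B. r' b * indicator U (d b)) \<le> enn2ereal (dirac_sum T B s d U)"
      if U: "openin T U" for U
    proof -
      have "(\<Sum>b\<in>B. r' b * indicator U (d b)) \<le> (\<Sum>b\<in>B. s b * indicator U (d b))"
        by (intro sum_mono mult_right_mono) (auto simp: s_def)
      moreover have "0 \<le> (\<Sum>b\<in>B. s b * indicator U (d b))"
        using s by (intro sum_nonneg) (auto simp: less_imp_le)
      moreover have "dirac_sum T B s d U = ennreal (\<Sum>b\<in>B. s b * indicator U (d b))"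
        using fB s U by (intro dirac_sum_apply) (auto simp: less_imp_le)
      ultimately show ?thesis by simp
    qed
    ultimately show ?thesis by blast
  qed
  moreover have "\<forall>b\<in>B. directed_in (topspace T) (specialization T) (?D b) \<and>
      directed_tendsto T (?D b) b"
    using way_below_directed_tendsto[OF cd T] BX by blast
  ultimately show ?thesis
    unfolding P_converges_def using B
    by (intro exI[of _ B] exI[of _ r] conjI refl exI[of _ ?D]) auto
qed

lemma P_opens_contains_way_below:
  assumes cd: "continuous_domain X le" and T: "T = scott_topology X le"
    and U: "\<U> \<in> P_opens T" and \<xi>: "\<xi> \<in> \<U>"
  shows "\<exists>\<xi>'\<in>\<U>. way_below (continuous_valuations T) (valuation_le T) \<xi>' \<xi>"
proof -
  obtain B r where B: "is_simple_rep T B r" and \<xi>_eq: "\<xi> = simple_valuation T B r"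
    using U \<xi> unfolding P_opens_def simple_valuations_def by blast
  have "lower_dirac_sums X le B r \<inter> \<U> \<noteq> {}"
    using U \<xi> directed_lower_dirac_sums[OF cd T B] P_converges_lower_dirac_sums[OF cd T B]
    unfolding P_opens_def \<xi>_eq by blast
  then obtain s d where "dirac_sum T B s d \<in> \<U>"
    and "\<forall>b\<in>B. 0 < s b \<and> s b < r b \<and> way_below X le (d b) b"
    unfolding lower_dirac_sums_def T by blast
  moreover have "finite B" "B \<subseteq> X"
    using B by (auto simp: is_simple_rep_def T topspace_scott_topology)
  ultimately show ?thesis
    using way_below_dirac_sum[OF cd T, of B s r d] unfolding \<xi>_eq by blast
qed

lemma P_opens_imp_scott_open_upper_closure:
  assumes cd: "continuous_domain X le" and T: "T = scott_topology X le"
    and U: "\<U> \<in> P_opens T"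
  shows "scott_open (continuous_valuations T) (valuation_le T)
           {\<nu> \<in> continuous_valuations T. \<exists>\<xi>\<in>\<U>. valuation_le T \<xi> \<nu>}"
    (is "scott_open ?V ?le ?W")
  unfolding scott_open_def
proof (intro conjI ballI allI impI)
  fix \<mu> \<nu> assume "\<mu> \<in> ?W" "\<nu> \<in> ?V" "?le \<mu> \<nu>"
  then show "\<nu> \<in> ?W" using valuation_le_trans by blast
next
  fix \<D> \<mu> assume *: "directed_in ?V ?le \<D> \<and> is_sup_in ?V ?le \<D> \<mu> \<and> \<mu> \<in> ?W"
  then obtain \<xi> where "\<xi> \<in> \<U>" and \<xi>: "?le \<xi> \<mu>" by blast
  then obtain \<xi>' where "\<xi>' \<in> \<U>" "way_below ?V ?le \<xi>' \<xi>"
    using P_opens_contains_way_below[OF cd T U] by blast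
  with * \<xi> obtain \<nu> where "\<nu> \<in> \<D>" "?le \<xi>' \<nu>"
    unfolding way_below_def by blast
  with * \<open>\<xi>' \<in> \<U>\<close> show "?W \<inter> \<D> \<noteq> {}"
    unfolding directed_in_def by blast
qed auto

theorem proposition4p9:
  fixes X :: "'a set" and le :: "'a \<Rightarrow> 'a \<Rightarrow> bool" and T :: "'a topology"
  assumes "continuous_domain X le"
    and "T = scott_topology X le"
  shows "P_opens T =
           {\<U>. openin (subtopology (scott_topology (continuous_valuations T) (valuation_le T))
                                    (simple_valuations T)) \<U>} \<and>
         P_space T =
           subtopology (scott_topology (continuous_valuations T) (valuation_le T))
                       (simple_valuations T)"
proof -
  let ?S = "subtopology (scott_topology (continuous_valuations T) (valuation_le T))
                        (simple_valuations T)"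
  have eq: "\<U> \<in> P_opens T \<longleftrightarrow> openin ?S \<U>" for \<U>
  proof
    assume "openin ?S \<U>"
    then show "\<U> \<in> P_opens T"
      using scott_open_Int_simple_in_P_opens
      by (auto simp: openin_subtopology openin_scott_topology)
  next
    assume U: "\<U> \<in> P_opens T"
    let ?W = "{\<nu> \<in> continuous_valuations T. \<exists>\<xi>\<in>\<U>. valuation_le T \<xi> \<nu>}"
    have sub: "\<U> \<subseteq> simple_valuations T" using U by (simp add: P_opens_def)
    \<comment> \<open>\<open>\<U>\<close> is an upper set among the simple valuations, so taking its upper closure adds none.\<close>
    have "\<U> = ?W \<inter> simple_valuations T"
      using P_opens_upper[OF U] sub simple_valuations_subset_continuous valuation_le_refl
      by blast
    then show "openin ?S \<U>"
      using P_opens_imp_scott_open_upper_closure[OF assms U]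
      unfolding openin_subtopology openin_scott_topology by blast
  qed
  moreover have "P_space T = ?S"
    using eq by (simp add: topology_eq openin_P_space)
  ultimately show ?thesis by blast
qed

end
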